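(* Let $a\in\mathbb{C}\setminus\{0,-1,-2,\ldots\}$, and let $z,s\in\mathbb{C}$ be such that the series defining the functions $H_k(z,s,a)$ converge absolutely (that is, $|z|<1$, or $|z|=1$ and $\operatorname{Re}(s)>3$). For every $k\in\mathbb{N}_0$, $$\Phi(z,s,a)=\frac{8}{3}H_k(z,s,a)-2H_{k+1}(z,s,a)+\frac13H_{k+2}(z,s,a),$$ $$D\Phi(z,s,a)=\frac{-4H_k(z,s,a)+5H_{k+1}(z,s,a)-H_{k+2}(z,s,a)}{3\cdot2^k},$$ $$D^2\Phi(z,s,a)=\frac{2H_k(z,s,a)-3H_{k+1}(z,s,a)+H_{k+2}(z,s,a)}{9\cdot4^k}.$$
   Context: $\mathbb{N}_0=\{0,1,2,\ldots\}$. The $k$-augmented centered triangular numbers are given by $A(r+1,k)=\frac32 4^k r^2+\frac32 2^k r+1$ for integers $r\ge0$. Complex powers are principal: $(r+a)^{-s}=\exp\{-s\operatorname{Log}(r+a)\}$, $-\pi<\operatorname{Arg}\le\pi$. The Hurwitz--Lerch transcendent is $\Phi(z,s,a)=\sum_{r=0}^{\infty}\frac{z^r}{(r+a)^s}$, and $H_k(z,s,a)=\sum_{r=0}^{\infty}\frac{A(r+1,k)z^r}{(r+a)^s}$. $D=z\frac{d}{dz}$ is the Euler operator; for $|z|<1$, $D^j\Phi(z,s,a)$ is the result of applying $D$ $j$ times to $\Phi$ in the variable $z$, and at points $|z|=1$ the symbol $D^j\Phi(z,s,a)$ means the termwise-differentiated series $\sum_{r\ge0} r^j z^r/(r+a)^s$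 (absolutely convergent there). *)

theory Defs
  imports "HOL-Complex_Analysis.Complex_Analysis"
begin

text \<open>The first argument is the index \<open>n = r + 1 \<ge> 1\<close>, so that
  \<open>aug_tri (r + 1) k = 3/2 * 4^k * r^2 + 3/2 * 2^k * r + 1\<close>. The value at \<open>n = 0\<close> is never used.\<close>

definition aug_tri :: "nat \<Rightarrow> nat \<Rightarrow> real" where
  "aug_tri n k = 3/2 * 4 ^ k * (real n - 1)\<^sup>2 + 3/2 * 2 ^ k * (real n - 1) + 1"

text \<open>For nonzero base, \<open>w powr (- s) = exp (- s * Ln w)\<close> with \<open>Ln\<close> the principal logarithm
  (imaginary part in \<open>{-pi<..pi}\<close>). The base \<open>r + a\<close> is nonzero for the parameters considered.
  Note also \<open>0 ^ 0 = 1\<close>.\<close>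

definition lerch_term :: "complex \<Rightarrow> complex \<Rightarrow> complex \<Rightarrow> nat \<Rightarrow> complex" where
  "lerch_term z s a r = z ^ r * (of_nat r + a) powr (- s)"

definition Lerch_Phi :: "complex \<Rightarrow> complex \<Rightarrow> complex \<Rightarrow> complex" where
  "Lerch_Phi z s a = (\<Sum>r. lerch_term z s a r)"

definition H_term :: "nat \<Rightarrow> complex \<Rightarrow> complex \<Rightarrow> complex \<Rightarrow> nat \<Rightarrow> complex" where
  "H_term k z s a r = of_real (aug_tri (r + 1) k) * lerch_term z s a r"

definition H :: "nat \<Rightarrow> complex \<Rightarrow> complex \<Rightarrow> complex \<Rightarrow> complex" where
  "H k z s a = (\<Sum>r. H_term k z s a r)"

definition euler_op :: "(complex \<Rightarrow> complex) \<Rightarrow> complex \<Rightarrow> complex" where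
  "euler_op f = (\<lambda>z. z * deriv f z)"

text \<open>Inside the unit disc this is the genuine \<open>j\<close>-fold Euler derivative of \<open>\<Phi>\<close> in \<open>z\<close>;
  on the unit circle, where \<open>\<Phi>\<close> need not be differentiable, the symbol denotes by convention
  the termwise differentiated series. Points with \<open>norm z > 1\<close> are irrelevant.\<close>

definition D_Phi :: "nat \<Rightarrow> complex \<Rightarrow> complex \<Rightarrow> complex \<Rightarrow> complex" where
  "D_Phi j z s a =
     (if norm z < 1 then (euler_op ^^ j) (\<lambda>w. Lerch_Phi w s a) z
      else (\<Sum>r. of_nat r ^ j * lerch_term z s a r))"

end

theory Submission
  imports Defs "HOL-Real_Asymp.Real_Asymp"
begin

text \<open>
  Once the sums converge, the three identities are linear algebra. Write
  \<open>S\<^sub>j = \<Sum>r. r ^ j * z ^ r * (r + a) powr (- s)\<close>. Since \<open>aug_tri (r + 1) k\<close> is a quadratic polynomial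
  in \<open>r\<close>, we have \<open>H\<^sub>k = 3/2 * 4 ^ k * S\<^sub>2 + 3/2 * 2 ^ k * S\<^sub>1 + S\<^sub>0\<close>. The indices \<open>k\<close>, \<open>k + 1\<close>, \<open>k + 2\<close>
  give a Vandermonde-type system in \<open>4 ^ k * S\<^sub>2\<close>, \<open>2 ^ k * S\<^sub>1\<close>, \<open>S\<^sub>0\<close> with the distinct nodes
  \<open>4\<close>, \<open>2\<close>, \<open>1\<close>, and the three formulas are its solution.

  Two analytic facts remain. First, \<open>S\<^sub>j\<close> has to be \<open>D\<^sup>j \<Phi>\<close>. On the unit circle this is the meaning
  of the symbol; inside the disc a power series may be differentiated termwise, so that the Euler
  operator multiplies the coefficient of \<open>z ^ r\<close> by \<open>r\<close> (\<open>euler_op_funpow_powser\<close>). Second, the domain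
  of absolute convergence has to be found. The argument of \<open>r + a\<close> is bounded, so its contribution to
  \<open>norm ((r + a) powr (- s))\<close> is a factor bounded above and below, and the \<open>r\<close>-th term of \<open>H\<^sub>k\<close> has the
  exact order \<open>r powr (2 - Re s) * norm z ^ r\<close> (\<open>norm_H_term_bigtheta\<close>). Convergence is thus decided by
  the geometric factor off the unit circle and by the exponent of \<open>r\<close> on it.
\<close>

section \<open>The Euler operator on power series\<close>

lemma euler_op_powser:
  fixes c :: "nat \<Rightarrow> complex"
  assumes sm: "\<And>w. norm w < K \<Longrightarrow> summable (\<lambda>n. c n * w ^ n)" and z: "norm z < K"
  shows "(\<lambda>n. (of_nat n * c n) * z ^ n) sums euler_op (\<lambda>w. \<Sum>n. c n * w ^ n) z"
proof -
  have "deriv (\<lambda>w. \<Sum>n. c n * w ^ n) z = (\<Sum>n. diffs c n * z ^ n)"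
    by (rule DERIV_imp_deriv[OF termdiffs_strong'[OF sm z]])
  moreover have "summable (\<lambda>n. diffs c n * z ^ n)"
    by (rule termdiff_converges[OF z sm])
  ultimately have "(\<lambda>n. z * (diffs c n * z ^ n)) sums euler_op (\<lambda>w. \<Sum>n. c n * w ^ n) z"
    unfolding euler_op_def by (simp add: summable_sums sums_mult)
  hence "(\<lambda>n. (of_nat (Suc n) * c (Suc n)) * z ^ Suc n) sums euler_op (\<lambda>w. \<Sum>n. c n * w ^ n) z"
    by (simp add: diffs_def mult_ac)
  \<comment> \<open>The shift in \<open>diffs\<close> loses nothing: the factor \<open>n\<close> kills the constant term.\<close>
  thus ?thesis
    by (subst (asm) sums_Suc_iff) simp
qed

text \<open>In the induction step the inner function is known to be a power series only on the disc; as the disc is open, this is enough to identify the derivatives.\<close>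

lemma euler_op_funpow_powser:
  fixes c :: "nat \<Rightarrow> complex"
  assumes sm: "\<And>w. norm w < K \<Longrightarrow> summable (\<lambda>n. c n * w ^ n)" and z: "norm z < K"
  shows "(\<lambda>n. (of_nat n ^ j * c n) * z ^ n) sums (euler_op ^^ j) (\<lambda>w. \<Sum>n. c n * w ^ n) z"
  using z
proof (induction j arbitrary: z)
  case 0
  thus ?case using sm by (simp add: summable_sums)
next
  case (Suc j)
  let ?g = "\<lambda>w. \<Sum>n. (of_nat n ^ j * c n) * w ^ n"
  have "eventually (\<lambda>w. w \<in> ball 0 K) (nhds z)"
    using Suc.prems by (intro eventually_nhds_in_open) auto
  hence "eventually (\<lambda>w. (euler_op ^^ j) (\<lambda>w. \<Sum>n. c n * w ^ n) w = ?g w) (nhds z)"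
    by eventually_elim (use Suc.IH in \<open>simp add: sums_iff\<close>)
  hence "euler_op ((euler_op ^^ j) (\<lambda>w. \<Sum>n. c n * w ^ n)) z = euler_op ?g z"
    unfolding euler_op_def by (simp add: deriv_cong_ev)
  moreover have "(\<lambda>n. (of_nat n * (of_nat n ^ j * c n)) * z ^ n) sums euler_op ?g z"
    by (rule euler_op_powser[where K = K]) (use Suc in \<open>auto simp: sums_iff\<close>)
  ultimately show ?case
    by (simp add: mult_ac)
qed

section \<open>The domain of absolute convergence\<close>

lemma norm_of_nat_add_bigtheta:
  "(\<lambda>r. norm (of_nat r + a :: complex)) \<in> \<Theta>(\<lambda>r. real r)"
proof (rule bigthetaI)
  have "(\<lambda>r. norm (of_nat r + a)) \<in> O(\<lambda>r. real r + norm a)"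
    by (intro bigoI[of _ 1] always_eventually allI) (simp add: norm_triangle_le)
  also have "(\<lambda>r. real r + norm a) \<in> O(\<lambda>r. real r)"
    by real_asymp
  finally show "(\<lambda>r. norm (of_nat r + a)) \<in> O(\<lambda>r. real r)" .
next
  have "eventually (\<lambda>r. real r \<ge> norm a) sequentially"
    by real_asymp
  hence "(\<lambda>r. real r - norm a) \<in> O(\<lambda>r. norm (of_nat r + a))"
    using norm_diff_ineq[of "of_nat _ :: complex" a]
    by (intro bigoI[of _ 1]) (auto elim!: eventually_mono)
  moreover have "(\<lambda>r. real r) \<in> O(\<lambda>r. real r - norm a)"
    by real_asymp
  ultimately show "(\<lambda>r. norm (of_nat r + a)) \<in> \<Omega>(\<lambda>r. real r)"
    unfolding bigomega_iff_bigo by (rule landau_o.big_trans[rotated])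
qed

text \<open>The imaginary part of the exponent only contributes the factor \<open>exp (Im s * Arg (r + a))\<close>,
  which lies between \<open>exp (- \<bar>Im s\<bar> * pi)\<close> and \<open>exp (\<bar>Im s\<bar> * pi)\<close>.\<close>

lemma norm_of_nat_add_powr_bigtheta:
  "(\<lambda>r. norm ((of_nat r + a :: complex) powr (- s))) \<in> \<Theta>(\<lambda>r. real r powr (- Re s))"
proof -
  have arg: "\<bar>Im s * Arg w\<bar> \<le> \<bar>Im s\<bar> * pi" for w
    using Arg_bounded[of w] by (simp add: abs_mult mult_left_mono abs_le_iff)
  have "(\<lambda>r. exp (Im s * Arg (of_nat r + a))) \<in> \<Theta>(\<lambda>_. 1 :: real)"
  proof (rule bigthetaI'[of "exp (- (\<bar>Im s\<bar> * pi))" "exp (\<bar>Im s\<bar> * pi)"])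
    show "eventually (\<lambda>r. exp (- (\<bar>Im s\<bar> * pi)) * norm (1 :: real) \<le> norm (exp (Im s * Arg (of_nat r + a)))
        \<and> norm (exp (Im s * Arg (of_nat r + a))) \<le> exp (\<bar>Im s\<bar> * pi) * norm (1 :: real)) sequentially"
      using arg[of "of_nat _ + a"] by (intro always_eventually) (auto simp: abs_le_iff minus_le_iff)
  qed auto
  moreover have "(\<lambda>r. norm (of_nat r + a) powr (- Re s)) \<in> \<Theta>(\<lambda>r. real r powr (- Re s))"
    using bigtheta_powr[OF norm_of_nat_add_bigtheta] by simp
  ultimately have "(\<lambda>r. norm (of_nat r + a) powr (- Re s) * exp (Im s * Arg (of_nat r + a)))
      \<in> \<Theta>(\<lambda>r. real r powr (- Re s) * 1)"
    by (intro landau_theta.mult)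
  thus ?thesis
    by (simp add: norm_powr_complex)
qed

lemma norm_H_term_bigtheta:
  "(\<lambda>r. norm (H_term k z s a r)) \<in> \<Theta>(\<lambda>r. real r powr (2 - Re s) * norm z ^ r)"
proof -
  have "(\<lambda>r. norm (aug_tri (r + 1) k)) \<in> \<Theta>(\<lambda>r. real r powr 2)"
    unfolding aug_tri_def real_norm_def by real_asymp
  hence "(\<lambda>r. norm (aug_tri (r + 1) k) * (norm z ^ r * norm ((of_nat r + a) powr (- s))))
      \<in> \<Theta>(\<lambda>r. real r powr 2 * (norm z ^ r * real r powr (- Re s)))"
    by (intro landau_theta.mult norm_of_nat_add_powr_bigtheta) auto
  also have "(\<lambda>r. real r powr 2 * (norm z ^ r * real r powr (- Re s)))
      = (\<lambda>r. real r powr (2 - Re s) * norm z ^ r)"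
    by (simp add: powr_diff powr_minus field_simps)
  finally show ?thesis
    by (simp add: H_term_def lerch_term_def norm_mult norm_power)
qed

lemma summable_powr_mult_power_iff:
  fixes x :: real
  assumes "x \<ge> 0"
  shows "summable (\<lambda>r. real r powr c * x ^ r) \<longleftrightarrow> x < 1 \<or> x = 1 \<and> c < -1"
proof -
  consider "x = 0" | "0 < x" "x < 1" | "x = 1" | "x > 1"
    using assms by linarith
  thus ?thesis
  proof cases
    case 1
    have "summable (\<lambda>r. real r powr c * 0 ^ r)"
      by (rule summable_finite[of "{0}"]) auto
    with 1 show ?thesis by simp
  next
    case 2
    have "(\<lambda>r. real r powr c * x ^ r) \<in> O(\<lambda>r. real r powr (-2))"
      using 2 by real_asymp
    moreover have "summable (\<lambda>r. norm (real r powr (-2)))"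
      by (simp add: summable_real_powr_iff)
    ultimately have "summable (\<lambda>r. real r powr c * x ^ r)"
      by (rule summable_comparison_test_bigo[rotated])
    with 2 show ?thesis by simp
  next
    case 3
    thus ?thesis by (simp add: summable_real_powr_iff)
  next
    case 4
    hence "filterlim (\<lambda>r. real r powr c * x ^ r) at_top sequentially"
      by real_asymp
    hence "\<not> summable (\<lambda>r. real r powr c * x ^ r)"
      using not_tendsto_and_filterlim_at_infinity[OF _ _ filterlim_at_top_imp_at_infinity]
        summable_LIMSEQ_zero sequentially_bot by metis
    with 4 show ?thesis by simp
  qed
qed

lemma summable_norm_H_term_iff:
  "summable (\<lambda>r. norm (H_term k z s a r)) \<longleftrightarrow> norm z < 1 \<or> norm z = 1 \<and> Re s > 3"
proof -
  let ?f = "\<lambda>r. norm (H_term k z s a r)" and ?g = "\<lambda>r. real r powr (2 - Re s) * norm z ^ r"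
  have "?f \<in> O(?g)" "?g \<in> O(?f)"
    using norm_H_term_bigtheta[of k z s a] by (auto simp: bigtheta_def bigomega_iff_bigo)
  hence "summable ?f \<longleftrightarrow> summable ?g"
    using summable_comparison_test_bigo[of ?g ?f] summable_comparison_test_bigo[of ?f ?g]
    by (auto simp: abs_mult)
  also have "\<dots> \<longleftrightarrow> norm z < 1 \<or> norm z = 1 \<and> Re s > 3"
    by (subst summable_powr_mult_power_iff) auto
  finally show ?thesis .
qed

section \<open>The moments of the Lerch series\<close>

text \<open>The monomials \<open>1\<close>, \<open>r\<close>, \<open>r\<^sup>2\<close> are all dominated by the single polynomial
  \<open>aug_tri (r + 1) 0 = 3/2 * r\<^sup>2 + 3/2 * r + 1\<close>, so the convergence of \<open>H\<^sub>0\<close> gives that of the moments.\<close>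

lemma summable_lerch_moment:
  assumes "norm z < 1 \<or> norm z = 1 \<and> Re s > 3" and "j \<le> 2"
  shows "summable (\<lambda>r. of_nat r ^ j * lerch_term z s a r)"
proof (rule summable_comparison_test')
  show "summable (\<lambda>r. norm (H_term 0 z s a r))"
    using assms(1) by (simp add: summable_norm_H_term_iff)
next
  fix r :: nat
  have "0 \<le> real r" "0 \<le> (real r)\<^sup>2"
    by simp_all
  moreover have "j = 0 \<or> j = 1 \<or> j = 2"
    using assms(2) by linarith
  ultimately have "real r ^ j \<le> \<bar>aug_tri (r + 1) 0\<bar>"
    unfolding aug_tri_def by (elim disjE; simp; linarith)
  thus "norm (of_nat r ^ j * lerch_term z s a r) \<le> norm (H_term 0 z s a r)"
    by (simp add: H_term_def norm_mult norm_power mult_right_mono)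
qed

lemma D_Phi_sums:
  assumes conv: "norm z < 1 \<or> norm z = 1 \<and> Re s > 3" and "j \<le> 2"
  shows "(\<lambda>r. of_nat r ^ j * lerch_term z s a r) sums D_Phi j z s a"
proof (cases "norm z < 1")
  case True
  have "summable (\<lambda>r. (of_nat r + a) powr (- s) * w ^ r)" if "norm w < 1" for w
    using summable_lerch_moment[of w s 0 a] that by (simp add: lerch_term_def mult_ac)
  from euler_op_funpow_powser[OF this True, of j] show ?thesis
    using True by (simp add: D_Phi_def Lerch_Phi_def lerch_term_def mult_ac)
next
  case False
  thus ?thesis
    using summable_lerch_moment[OF assms] by (simp add: D_Phi_def summable_sums)
qed

lemma D_Phi_0: "D_Phi 0 z s a = Lerch_Phi z s a"
  by (simp add: D_Phi_def Lerch_Phi_def)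

lemma H_eq_D_Phi:
  assumes "norm z < 1 \<or> norm z = 1 \<and> Re s > 3"
  shows "H k z s a = 3/2 * 4 ^ k * D_Phi 2 z s a + 3/2 * 2 ^ k * D_Phi 1 z s a + Lerch_Phi z s a"
proof -
  have "(\<lambda>r. 3/2 * 4 ^ k * (of_nat r ^ 2 * lerch_term z s a r)
      + 3/2 * 2 ^ k * (of_nat r ^ 1 * lerch_term z s a r) + of_nat r ^ 0 * lerch_term z s a r)
      sums (3/2 * 4 ^ k * D_Phi 2 z s a + 3/2 * 2 ^ k * D_Phi 1 z s a + D_Phi 0 z s a)"
    by (intro sums_add sums_mult D_Phi_sums assms) auto
  also have "(\<lambda>r. 3/2 * 4 ^ k * (of_nat r ^ 2 * lerch_term z s a r)
      + 3/2 * 2 ^ k * (of_nat r ^ 1 * lerch_term z s a r) + of_nat r ^ 0 * lerch_term z s a r)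
      = H_term k z s a"
    by (simp add: H_term_def aug_tri_def fun_eq_iff algebra_simps)
  finally show ?thesis
    by (simp add: H_def sums_iff D_Phi_0)
qed

section \<open>The inversion formulas\<close>

theorem corollary5p3:
  fixes a z s :: complex
  assumes "a \<notin> \<int>\<^sub>\<le>\<^sub>0"
  shows "(\<forall>k. summable (\<lambda>r. norm (H_term k z s a r)) \<longleftrightarrow>
            norm z < 1 \<or> (norm z = 1 \<and> Re s > 3)) \<and>
         (norm z < 1 \<or> (norm z = 1 \<and> Re s > 3) \<longrightarrow>
           (\<forall>k. Lerch_Phi z s a = 8/3 * H k z s a - 2 * H (k+1) z s a + 1/3 * H (k+2) z s a \<and>
                D_Phi 1 z s a = (- 4 * H k z s a + 5 * H (k+1) z s a - H (k+2) z s a) / (3 * 2 ^ k) \<and>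
                D_Phi 2 z s a = (2 * H k z s a - 3 * H (k+1) z s a + H (k+2) z s a) / (9 * 4 ^ k)))"
proof (intro conjI allI impI)
  show "summable (\<lambda>r. norm (H_term k z s a r)) \<longleftrightarrow> norm z < 1 \<or> (norm z = 1 \<and> Re s > 3)" for k
    by (rule summable_norm_H_term_iff)
next
  fix k
  assume conv: "norm z < 1 \<or> (norm z = 1 \<and> Re s > 3)"
  note H = H_eq_D_Phi[OF conv]
  show "Lerch_Phi z s a = 8/3 * H k z s a - 2 * H (k+1) z s a + 1/3 * H (k+2) z s a"
    by (simp add: H field_simps)
  show "D_Phi 1 z s a = (- 4 * H k z s a + 5 * H (k+1) z s a - H (k+2) z s a) / (3 * 2 ^ k)"
    by (simp add: H field_simps)
  show "D_Phi 2 z s a = (2 * H k z s a - 3 * H (k+1) z s a + H (k+2) z s a) / (9 * 4 ^ k)"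
    by (simp add: H field_simps)
qed

end
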